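(* The mapping $T\colon \mathscr{P}(\mathbb{C})\to \mathscr{P}(\mathbb{C})$ fulfills the Leibniz rule $$T(p\cdot q)=T(p)\cdot q+p\cdot T(q)$$ for all $p,q\in \mathscr{P}(\mathbb{C})$ if and only if there exist sequences of functions $(\psi_k)_{k\in\mathbb{N}_0}$ and $(\tilde\varphi_k)_{k\in\mathbb{N}_0}$, with $\psi_k,\tilde\varphi_k\colon\mathbb{C}\to\mathbb{C}$, such that for all $k\in\mathbb{N}_0$ we have $\tilde\varphi_k(ab)=a\tilde\varphi_k(b)+b\tilde\varphi_k(a)$ for all $a,b\in\mathbb{C}$, and such that $$T(p)(z)=a\cdot\sum_{j=1}^{N}\Big(\prod_{i\neq j}(z-z_i)\Big)\cdot\Big(\sum_{k=0}^{n}\psi_k(-z_j)z^k+\sum_{k=0}^{n}\tilde\varphi_k(-z_j)z^k\Big)+\Big(\sum_{k=0}^{n}\tilde\varphi_k(a)z^k\Big)\prod_{j=1}^{N}(z-z_j),$$ provided that $p(z)=a\prod_{j=1}^{N}(z-z_j)$ and $n\in\mathbb{N}_0$ depends upon $p$.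
   Context: $\mathscr{P}(\mathbb{C})$ denotes the set of all polynomials $p\colon\mathbb{C}\to\mathbb{C}$ with complex coefficients, with pointwise addition and multiplication. The operator $T$ is not assumed to be linear or additive. $\mathbb{N}_0$ is the set of nonnegative integers. Every $p\in\mathscr{P}(\mathbb{C})$ is written as $p(z)=a\prod_{j=1}^{N}(z-z_j)$ with a nonnegative integer $N$ and complex numbers $a,z_1,\dots,z_N$; in $\prod_{i\neq j}$ the index $i$ ranges over $\{1,\dots,N\}\setminus\{j\}$.
   Formalization: "n depends upon p" is taken to mean that the formula holds for all sufficiently large n, with the threshold depending on p; if only some n is required for each p, the "if" direction is false. *)

theory Defs
  imports Complex_Main "HOL-Computational_Algebra.Polynomial"
begin

end

theory Submission
  imports Defs "HOL-Computational_Algebra.Fundamental_Theorem_Algebra"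
begin

text \<open>
  A map obeying the Leibniz rule is determined on a product by its values on the factors. Over the
  complex numbers every polynomial is a constant times a product of factors \<open>z - \<zeta>\<close>, so \<open>T\<close> is
  determined by its values on constants and on monic linear polynomials. Let \<open>\<phi>\<^sub>k(c)\<close> be the \<open>k\<close>-th
  coefficient of \<open>T\<close> at the constant \<open>c\<close>, and let \<open>\<psi>\<^sub>k(c) + \<phi>\<^sub>k(c)\<close> be the \<open>k\<close>-th coefficient of \<open>T\<close>
  at \<open>z + c\<close>. The Leibniz rule on constants, read coefficientwise, is the functional equation of
  \<open>\<phi>\<^sub>k\<close>, and the iterated Leibniz rule (\<open>leibniz_prod\<close>) is the claimed formula. Any \<open>n\<close> that bounds the
  degrees of \<open>T\<close> at the leading coefficient and at the finitely many linear factors of \<open>p\<close> is large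
  enough. Only \<open>p = 0\<close> has factorizations with arbitrary roots; there both sides vanish.

  Conversely, concatenating factorizations of \<open>p\<close> and \<open>q\<close> gives a factorization of \<open>p q\<close>. For an \<open>n\<close>
  large enough for \<open>p\<close>, \<open>q\<close> and \<open>p q\<close> at once, the sum over the factors splits into the two Leibniz
  terms (\<open>sum_prod_concat\<close>), and the functional equation splits the term of the leading
  coefficient \<open>a b\<close>. That such a common \<open>n\<close> exists is where it matters that the formula holds for all
  large \<open>n\<close> and not just for one.
\<close>

section \<open>Products with one factor omitted\<close>

text \<open>
  This is the product rule for a product of functions with values \<open>f i\<close> and derivatives \<open>g i\<close>, when
  the product is cut into two blocks.
\<close>

lemma sum_prod_omit_Un_disjoint:
  fixes f g :: "'i \<Rightarrow> 'a::comm_semiring_1"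
  assumes "finite A" "finite B" "A \<inter> B = {}"
  shows "(\<Sum>j\<in>A \<union> B. (\<Prod>i\<in>(A \<union> B) - {j}. f i) * g j) =
    (\<Sum>j\<in>A. (\<Prod>i\<in>A - {j}. f i) * g j) * (\<Prod>i\<in>B. f i)
      + (\<Prod>i\<in>A. f i) * (\<Sum>j\<in>B. (\<Prod>i\<in>B - {j}. f i) * g j)"
proof -
  have "(\<Prod>i\<in>(A \<union> B) - {j}. f i) = (\<Prod>i\<in>A - {j}. f i) * (\<Prod>i\<in>B. f i)" if "j \<in> A" for j
  proof -
    have "(A \<union> B) - {j} = (A - {j}) \<union> B"
      using that assms by auto
    then show ?thesis
      using assms by (simp only:) (rule prod.union_disjoint, auto)
  qed
  moreover have "(\<Prod>i\<in>(A \<union> B) - {j}. f i) = (\<Prod>i\<in>A. f i) * (\<Prod>i\<in>B - {j}. f i)" if "j \<in> B" for j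
  proof -
    have "(A \<union> B) - {j} = A \<union> (B - {j})"
      using that assms by auto
    then show ?thesis
      using assms by (simp only:) (rule prod.union_disjoint, auto)
  qed
  ultimately show ?thesis
    using assms by (simp add: sum.union_disjoint sum_distrib_left sum_distrib_right mult_ac)
qed

text \<open>
  The same rule for two sequences laid end to end, with the second block reindexed from \<open>1\<close>.
\<close>

lemma sum_prod_concat:
  fixes f f' g g' :: "nat \<Rightarrow> 'a::comm_semiring_1" and N M :: nat
  defines "h \<equiv> \<lambda>i. if i \<le> N then f i else f' (i - N)"
    and "k \<equiv> \<lambda>i. if i \<le> N then g i else g' (i - N)"
  shows "(\<Sum>j=1..N + M. (\<Prod>i\<in>{1..N + M} - {j}. h i) * k j) =
    (\<Sum>j=1..N. (\<Prod>i\<in>{1..N} - {j}. f i) * g j) * (\<Prod>i=1..M. f' i)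
      + (\<Prod>i=1..N. f i) * (\<Sum>j=1..M. (\<Prod>i\<in>{1..M} - {j}. f' i) * g' j)"
    and "(\<Prod>i=1..N + M. h i) = (\<Prod>i=1..N. f i) * (\<Prod>i=1..M. f' i)"
proof -
  let ?B = "(\<lambda>i. i + N) ` {1..M}"
  have split: "{1..N + M} = {1..N} \<union> ?B" and disj: "{1..N} \<inter> ?B = {}"
    by (auto simp: image_add_atLeastAtMost)
  have low: "(\<Prod>i\<in>S. h i) = (\<Prod>i\<in>S. f i)" if "S \<subseteq> {1..N}" for S
    using that by (intro prod.cong) (auto simp: h_def)
  have high: "(\<Prod>i\<in>(\<lambda>i. i + N) ` S. h i) = (\<Prod>i\<in>S. f' i)" if "S \<subseteq> {1..M}" for S
    using that by (subst prod.reindex) (auto simp: h_def intro!: prod.cong)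
  have "(\<Sum>j\<in>?B. (\<Prod>i\<in>?B - {j}. h i) * k j) = (\<Sum>j=1..M. (\<Prod>i\<in>{1..M} - {j}. f' i) * g' j)"
  proof (subst sum.reindex, simp, intro sum.cong refl)
    fix j assume j: "j \<in> {1..M}"
    have "?B - {j + N} = (\<lambda>i. i + N) ` ({1..M} - {j})"
      using image_set_diff[of "\<lambda>i. i + N" "{1..M}" "{j}"] by (simp add: inj_def)
    then have "(\<Prod>i\<in>?B - {j + N}. h i) = (\<Prod>i\<in>{1..M} - {j}. f' i)"
      using high[of "{1..M} - {j}"] by (simp only: Diff_subset)
    moreover have "k (j + N) = g' j"
      using j by (auto simp: k_def)
    ultimately show "((\<lambda>j. (\<Prod>i\<in>?B - {j}. h i) * k j) \<circ> (\<lambda>i. i + N)) j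
        = (\<Prod>i\<in>{1..M} - {j}. f' i) * g' j"
      by (simp only: o_def)
  qed
  moreover have "(\<Sum>j=1..N. (\<Prod>i\<in>{1..N} - {j}. h i) * k j) =
      (\<Sum>j=1..N. (\<Prod>i\<in>{1..N} - {j}. f i) * g j)"
    by (intro sum.cong refl) (simp add: low k_def)
  ultimately show "(\<Sum>j=1..N + M. (\<Prod>i\<in>{1..N + M} - {j}. h i) * k j) =
    (\<Sum>j=1..N. (\<Prod>i\<in>{1..N} - {j}. f i) * g j) * (\<Prod>i=1..M. f' i)
      + (\<Prod>i=1..N. f i) * (\<Sum>j=1..M. (\<Prod>i\<in>{1..M} - {j}. f' i) * g' j)"
    by (simp only: split sum_prod_omit_Un_disjoint[OF _ _ disj] low high order_refl
        finite_atLeastAtMost finite_imageI)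
  show "(\<Prod>i=1..N + M. h i) = (\<Prod>i=1..N. f i) * (\<Prod>i=1..M. f' i)"
    by (simp only: split prod.union_disjoint[OF _ _ disj] low high order_refl
        finite_atLeastAtMost finite_imageI)
qed

section \<open>Polynomials as values and as products of linear factors\<close>

lemma poly_eq_sum_coeff:
  fixes p :: "'a::comm_semiring_1 poly"
  assumes "degree p \<le> n"
  shows "poly p z = (\<Sum>k=0..n. coeff p k * z ^ k)"
  unfolding poly_altdef
  using assms by (intro sum.mono_neutral_left) (auto simp: coeff_eq_0)

lemma ex_linear_factorization:
  fixes p :: "'a::alg_closed_field poly"
  shows "\<exists>(N::nat) a \<zeta>. p = smult a (\<Prod>j=1..N. [:- \<zeta> j, 1:])"
proof (cases "p = 0")
  case True
  then show ?thesis
    by (intro exI[of _ 0] exI[of _ "\<lambda>_. 0"]) simp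
next
  case False
  have mset: "\<exists>(N::nat) \<zeta>. (\<Prod>x\<in>#A. [:- x, 1:]) = (\<Prod>j=1..N. [:- \<zeta> j, 1:])" for A :: "'a multiset"
  proof (induction A)
    case empty
    show ?case
      by (rule exI[of _ 0]) simp
  next
    case (add x A)
    then obtain N :: nat and \<zeta> where IH: "(\<Prod>x\<in>#A. [:- x, 1:]) = (\<Prod>j=1..N. [:- \<zeta> j, 1:])"
      by blast
    have "(\<Prod>j=1..N. [:- (\<zeta>(Suc N := x)) j, 1:]) = (\<Prod>j=1..N. [:- \<zeta> j, 1:])"
      by (intro prod.cong) auto
    then show ?case
      using IH by (intro exI[of _ "Suc N"] exI[of _ "\<zeta>(Suc N := x)"]) (simp add: mult.commute)
  qed
  obtain A where A: "p = smult (lead_coeff p) (\<Prod>x\<in>#A. [:- x, 1:])"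
    using alg_closed_imp_factorization[OF False] by blast
  from mset[of A] show ?thesis
    by (subst A) (elim exE, intro exI, simp only:)
qed

text \<open>
  Pointwise factorizations determine the polynomial, as the field is infinite.
\<close>

lemma eq_linear_product_iff:
  fixes p :: "'a::field_char_0 poly"
  shows "(\<forall>z. poly p z = a * (\<Prod>j=1..N. z - \<zeta> j)) \<longleftrightarrow> p = smult a (\<Prod>j=1..N. [:- \<zeta> j, 1:])"
proof -
  have "p = smult a (\<Prod>j=1..N. [:- \<zeta> j, 1:]) \<longleftrightarrow> poly p = poly (smult a (\<Prod>j=1..N. [:- \<zeta> j, 1:]))"
    by (simp only: poly_eq_poly_eq_iff)
  then show ?thesis
    by (simp add: fun_eq_iff poly_prod)
qed

section \<open>Iterated Leibniz rule\<close>

lemma leibniz_0: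
  fixes T :: "'a::comm_ring_1 \<Rightarrow> 'a"
  assumes "\<And>p q. T (p * q) = T p * q + p * T q"
  shows "T 0 = 0"
  using assms[of 0 0] by simp

lemma leibniz_prod:
  fixes T :: "'a::comm_ring_1 \<Rightarrow> 'a"
  assumes leibniz: "\<And>p q. T (p * q) = T p * q + p * T q" and "finite A"
  shows "T (\<Prod>i\<in>A. f i) = (\<Sum>j\<in>A. (\<Prod>i\<in>A - {j}. f i) * T (f j))"
  using \<open>finite A\<close>
proof (induction A rule: finite_induct)
  case empty
  show ?case
    using leibniz[of 1 1] by simp
next
  case (insert x A)
  then show ?case
    using sum_prod_omit_Un_disjoint[of "{x}" A f "\<lambda>j. T (f j)"] by (simp add: leibniz)
qed

section \<open>The two directions\<close>

text \<open>
  This is the iterated Leibniz rule for \<open>[:a:]\<close> times the linear factors, evaluated at \<open>z\<close>. The bound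
  \<open>n\<^sub>0\<close> must serve all factorizations of \<open>p\<close> at once. For \<open>p \<noteq> 0\<close> this is possible because the leading
  coefficient is determined and every \<open>\<zeta> j\<close> is one of the finitely many roots. For \<open>p = 0\<close> the
  \<open>\<zeta> j\<close> are arbitrary, but \<open>a = 0\<close> and \<open>T 0 = 0\<close> make both sides zero for every \<open>n\<close>.
\<close>

lemma leibniz_imp_formula:
  fixes T :: "complex poly \<Rightarrow> complex poly"
  assumes leibniz: "\<And>p q. T (p * q) = T p * q + p * T q"
  defines "\<phi> \<equiv> \<lambda>k c. coeff (T [:c:]) k"
  defines "\<psi> \<equiv> \<lambda>k c. coeff (T [:c, 1:]) k - \<phi> k c"
  shows "\<exists>n\<^sub>0. \<forall>n\<ge>n\<^sub>0. \<forall>(N::nat) a \<zeta>.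
        (\<forall>z. poly p z = a * (\<Prod>j=1..N. z - \<zeta> j)) \<longrightarrow>
        (\<forall>z. poly (T p) z =
          a * (\<Sum>j=1..N. (\<Prod>i\<in>{1..N} - {j}. z - \<zeta> i) *
                 ((\<Sum>k=0..n. \<psi> k (- \<zeta> j) * z ^ k) + (\<Sum>k=0..n. \<phi> k (- \<zeta> j) * z ^ k)))
          + (\<Sum>k=0..n. \<phi> k a * z ^ k) * (\<Prod>j=1..N. z - \<zeta> j))"
proof -
  define D where "D = insert (degree (T [:lead_coeff p:]))
    ((\<lambda>w. degree (T [:- w, 1:])) ` {w. poly p w = 0})"
  show ?thesis
  proof (intro exI[of _ "Max D"] allI impI)
    fix n N :: nat and a :: complex and \<zeta> :: "nat \<Rightarrow> complex" and z :: complex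
    assume n: "Max D \<le> n" and "\<forall>z. poly p z = a * (\<Prod>j=1..N. z - \<zeta> j)"
    then have p: "p = smult a (\<Prod>j=1..N. [:- \<zeta> j, 1:])"
      by (simp only: eq_linear_product_iff)
    have lead: "lead_coeff p = a"
      unfolding p lead_coeff_smult lead_coeff_prod by simp
    show "poly (T p) z =
          a * (\<Sum>j=1..N. (\<Prod>i\<in>{1..N} - {j}. z - \<zeta> i) *
                 ((\<Sum>k=0..n. \<psi> k (- \<zeta> j) * z ^ k) + (\<Sum>k=0..n. \<phi> k (- \<zeta> j) * z ^ k)))
          + (\<Sum>k=0..n. \<phi> k a * z ^ k) * (\<Prod>j=1..N. z - \<zeta> j)"
    proof (cases "a = 0")
      case True
      then show ?thesis
        using p leibniz_0[OF leibniz] by (simp add: \<phi>_def)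
    next
      case False
      then have "p \<noteq> 0"
        using lead by auto
      then have bound: "d \<le> n" if "d \<in> D" for d
        using that n Max_ge[of D d] by (auto simp: D_def poly_roots_finite)
      have const: "poly (T [:a:]) z = (\<Sum>k=0..n. \<phi> k a * z ^ k)"
        unfolding \<phi>_def using lead by (intro poly_eq_sum_coeff bound) (simp add: D_def)
      have linear: "poly (T [:- \<zeta> j, 1:]) z =
          (\<Sum>k=0..n. \<psi> k (- \<zeta> j) * z ^ k) + (\<Sum>k=0..n. \<phi> k (- \<zeta> j) * z ^ k)"
        if "j \<in> {1..N}" for j
      proof -
        have "poly p (\<zeta> j) = 0"
          using that by (auto simp: p poly_prod)
        then have "degree (T [:- \<zeta> j, 1:]) \<le> n"
          by (intro bound) (auto simp: D_def)
        then show ?thesis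
          by (simp add: poly_eq_sum_coeff \<psi>_def sum.distrib[symmetric] distrib_right[symmetric])
      qed
      have "T p = T ([:a:] * (\<Prod>j=1..N. [:- \<zeta> j, 1:]))"
        by (simp add: p)
      also have "\<dots> = T [:a:] * (\<Prod>j=1..N. [:- \<zeta> j, 1:])
          + [:a:] * (\<Sum>j=1..N. (\<Prod>i\<in>{1..N} - {j}. [:- \<zeta> i, 1:]) * T [:- \<zeta> j, 1:])"
        by (simp only: leibniz leibniz_prod[OF leibniz] finite_atLeastAtMost)
      finally have "poly (T p) z = poly (T [:a:]) z * (\<Prod>j=1..N. z - \<zeta> j)
          + a * (\<Sum>j=1..N. (\<Prod>i\<in>{1..N} - {j}. z - \<zeta> i) * poly (T [:- \<zeta> j, 1:]) z)"
        by (simp add: poly_prod poly_sum)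
      also have "(\<Sum>j=1..N. (\<Prod>i\<in>{1..N} - {j}. z - \<zeta> i) * poly (T [:- \<zeta> j, 1:]) z) =
          (\<Sum>j=1..N. (\<Prod>i\<in>{1..N} - {j}. z - \<zeta> i) *
            ((\<Sum>k=0..n. \<psi> k (- \<zeta> j) * z ^ k) + (\<Sum>k=0..n. \<phi> k (- \<zeta> j) * z ^ k)))"
        by (intro sum.cong refl) (simp only: linear)
      finally show ?thesis
        by (simp only: const add.commute)
    qed
  qed
qed

text \<open>
  Evaluating at a fixed point and truncating the sums at a common \<open>n\<close> leaves only two functions, the
  value \<open>G \<zeta>\<close> attached to a root and the value \<open>H a\<close> attached to a leading coefficient. Such an
  \<open>n\<close> can serve only finitely many polynomials, hence the restriction of the formula to \<open>p\<close>, \<open>q\<close> and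
  \<open>p * q\<close>; at \<open>p * q\<close> it is applied to the concatenation of a factorization of \<open>p\<close> with one of \<open>q\<close>.
\<close>

lemma formula_imp_leibniz:
  fixes t :: "complex poly \<Rightarrow> complex" and G H :: "complex \<Rightarrow> complex" and p q :: "complex poly"
  assumes H: "\<And>a b. H (a * b) = a * H b + b * H a"
    and t: "\<And>r (N::nat) a \<zeta>. r \<in> {p, q, p * q} \<Longrightarrow> r = smult a (\<Prod>j=1..N. [:- \<zeta> j, 1:]) \<Longrightarrow>
        t r = a * (\<Sum>j=1..N. (\<Prod>i\<in>{1..N} - {j}. z - \<zeta> i) * G (\<zeta> j)) + H a * (\<Prod>j=1..N. z - \<zeta> j)"
  shows "t (p * q) = t p * poly q z + poly p z * t q"
proof -
  obtain N :: nat and a \<zeta> where p: "p = smult a (\<Prod>j=1..N. [:- \<zeta> j, 1:])"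
    using ex_linear_factorization by blast
  obtain M :: nat and b \<omega> where q: "q = smult b (\<Prod>j=1..M. [:- \<omega> j, 1:])"
    using ex_linear_factorization by blast
  define \<xi> where "\<xi> = (\<lambda>i. if i \<le> N then \<zeta> i else \<omega> (i - N))"
  have \<xi>: "F (\<xi> i) = (if i \<le> N then F (\<zeta> i) else F (\<omega> (i - N)))" for F :: "complex \<Rightarrow> 'b" and i
    by (simp add: \<xi>_def)
  note concat_poly =
    sum_prod_concat(2)[where f = "\<lambda>j. [:- \<zeta> j, 1:]" and f' = "\<lambda>j. [:- \<omega> j, 1:]" and N = N and M = M]
  note concat_z =
    sum_prod_concat(1)[where f = "\<lambda>j. z - \<zeta> j" and f' = "\<lambda>j. z - \<omega> j"
      and g = "\<lambda>j. G (\<zeta> j)" and g' = "\<lambda>j. G (\<omega> j)" and N = N and M = M]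
    sum_prod_concat(2)[where f = "\<lambda>j. z - \<zeta> j" and f' = "\<lambda>j. z - \<omega> j" and N = N and M = M]
  have "p * q = smult (a * b) (\<Prod>j=1..N + M. [:- \<xi> j, 1:])"
    unfolding \<xi>[of "\<lambda>x. [:- x, 1:]"] concat_poly by (simp add: p q mult.commute)
  then have "t (p * q) = a * b * (\<Sum>j=1..N + M. (\<Prod>i\<in>{1..N + M} - {j}. z - \<xi> i) * G (\<xi> j))
      + H (a * b) * (\<Prod>j=1..N + M. z - \<xi> j)"
    by (intro t) auto
  also have "\<dots> = a * b *
       ((\<Sum>j=1..N. (\<Prod>i\<in>{1..N} - {j}. z - \<zeta> i) * G (\<zeta> j)) * (\<Prod>i=1..M. z - \<omega> i)
        + (\<Prod>i=1..N. z - \<zeta> i) * (\<Sum>j=1..M. (\<Prod>i\<in>{1..M} - {j}. z - \<omega> i) * G (\<omega> j)))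
      + H (a * b) * ((\<Prod>i=1..N. z - \<zeta> i) * (\<Prod>i=1..M. z - \<omega> i))"
    unfolding \<xi>[of "\<lambda>x. z - x"] \<xi>[of G] concat_z ..
  also have "\<dots> = t p * poly q z + poly p z * t q"
  proof -
    have "poly p z = a * (\<Prod>j=1..N. z - \<zeta> j)" "poly q z = b * (\<Prod>j=1..M. z - \<omega> j)"
      by (simp_all add: p q poly_prod)
    moreover have "t p = a * (\<Sum>j=1..N. (\<Prod>i\<in>{1..N} - {j}. z - \<zeta> i) * G (\<zeta> j))
        + H a * (\<Prod>j=1..N. z - \<zeta> j)"
      by (rule t[OF _ p]) simp
    moreover have "t q = b * (\<Sum>j=1..M. (\<Prod>i\<in>{1..M} - {j}. z - \<omega> i) * G (\<omega> j))
        + H b * (\<Prod>j=1..M. z - \<omega> j)"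
      by (rule t[OF _ q]) simp
    ultimately show ?thesis
      by (simp only: H ring_distribs mult_ac add_ac)
  qed
  finally show ?thesis .
qed

theorem theorem4:
  fixes T :: "complex poly \<Rightarrow> complex poly"
  shows "(\<forall>p q. T (p * q) = T p * q + p * T q) \<longleftrightarrow>
    (\<exists>(\<psi> :: nat \<Rightarrow> complex \<Rightarrow> complex) (\<phi> :: nat \<Rightarrow> complex \<Rightarrow> complex).
      (\<forall>k a b. \<phi> k (a * b) = a * \<phi> k b + b * \<phi> k a) \<and>
      (\<forall>p. \<exists>n\<^sub>0. \<forall>n\<ge>n\<^sub>0. \<forall>(N :: nat) (a :: complex) (\<zeta> :: nat \<Rightarrow> complex).
        (\<forall>z. poly p z = a * (\<Prod>j=1..N. z - \<zeta> j)) \<longrightarrow>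
        (\<forall>z. poly (T p) z =
          a * (\<Sum>j=1..N. (\<Prod>i\<in>{1..N} - {j}. z - \<zeta> i) *
                 ((\<Sum>k=0..n. \<psi> k (- \<zeta> j) * z ^ k) + (\<Sum>k=0..n. \<phi> k (- \<zeta> j) * z ^ k)))
          + (\<Sum>k=0..n. \<phi> k a * z ^ k) * (\<Prod>j=1..N. z - \<zeta> j))))"
    (is "?L \<longleftrightarrow> (\<exists>\<psi> \<phi>. ?E \<phi> \<and> (\<forall>p. \<exists>n\<^sub>0. \<forall>n\<ge>n\<^sub>0. ?F \<psi> \<phi> p n))")
proof
  assume L: ?L
  define \<phi> where "\<phi> = (\<lambda>k c. coeff (T [:c:]) k)"
  define \<psi> where "\<psi> = (\<lambda>k c. coeff (T [:c, 1:]) k - \<phi> k c)"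
  have "?E \<phi>"
  proof (intro allI)
    fix k a b
    have "T [:a * b:] = T ([:a:] * [:b:])"
      by (simp add: mult.commute)
    also have "\<dots> = smult b (T [:a:]) + smult a (T [:b:])"
      by (simp only: L[rule_format]) simp
    finally show "\<phi> k (a * b) = a * \<phi> k b + b * \<phi> k a"
      by (simp add: \<phi>_def)
  qed
  moreover have "\<forall>p. \<exists>n\<^sub>0. \<forall>n\<ge>n\<^sub>0. ?F \<psi> \<phi> p n"
    unfolding \<psi>_def \<phi>_def by (rule allI, rule leibniz_imp_formula) (simp only: L[rule_format])
  ultimately show "\<exists>\<psi> \<phi>. ?E \<phi> \<and> (\<forall>p. \<exists>n\<^sub>0. \<forall>n\<ge>n\<^sub>0. ?F \<psi> \<phi> p n)"
    by (intro exI conjI)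
next
  assume "\<exists>\<psi> \<phi>. ?E \<phi> \<and> (\<forall>p. \<exists>n\<^sub>0. \<forall>n\<ge>n\<^sub>0. ?F \<psi> \<phi> p n)"
  then obtain \<psi> \<phi> where E: "?E \<phi>" and F: "\<forall>p. \<exists>n\<^sub>0. \<forall>n\<ge>n\<^sub>0. ?F \<psi> \<phi> p n"
    by (elim exE conjE)
  from choice[OF F] obtain n\<^sub>0 where n\<^sub>0: "\<forall>p. \<forall>n\<ge>n\<^sub>0 p. ?F \<psi> \<phi> p n" ..
  show ?L
  proof (intro allI)
    fix p q
    define n where "n = Max {n\<^sub>0 p, n\<^sub>0 q, n\<^sub>0 (p * q)}"
    have "poly (T (p * q)) z = poly (T p) z * poly q z + poly p z * poly (T q) z" for z
    proof (rule formula_imp_leibniz[where H = "\<lambda>a. \<Sum>k=0..n. \<phi> k a * z ^ k"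
          and G = "\<lambda>x. (\<Sum>k=0..n. \<psi> k (- x) * z ^ k) + (\<Sum>k=0..n. \<phi> k (- x) * z ^ k)"])
      show "(\<Sum>k=0..n. \<phi> k (a * b) * z ^ k) =
          a * (\<Sum>k=0..n. \<phi> k b * z ^ k) + b * (\<Sum>k=0..n. \<phi> k a * z ^ k)" for a b
        using E by (simp add: sum_distrib_left sum.distrib distrib_right mult.assoc)
    next
      fix r and N :: nat and a \<zeta>
      assume "r \<in> {p, q, p * q}" and r: "r = smult a (\<Prod>j=1..N. [:- \<zeta> j, 1:])"
      then have "n\<^sub>0 r \<le> n"
        by (auto simp: n_def)
      then have "?F \<psi> \<phi> r n"
        by (rule n\<^sub>0[THEN spec, THEN spec, THEN mp])
      from this[unfolded eq_linear_product_iff, THEN spec, THEN spec, THEN spec, THEN mp, OF r]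
      show "poly (T r) z = a * (\<Sum>j=1..N. (\<Prod>i\<in>{1..N} - {j}. z - \<zeta> i) *
            ((\<Sum>k=0..n. \<psi> k (- \<zeta> j) * z ^ k) + (\<Sum>k=0..n. \<phi> k (- \<zeta> j) * z ^ k)))
          + (\<Sum>k=0..n. \<phi> k a * z ^ k) * (\<Prod>j=1..N. z - \<zeta> j)" ..
    qed
    then have "poly (T (p * q)) = poly (T p * q + p * T q)"
      by (simp add: fun_eq_iff)
    then show "T (p * q) = T p * q + p * T q"
      by (simp only: poly_eq_poly_eq_iff)
  qed
qed

end
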